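(* Let $M,N\ge 1$ be integers and $\sigma^2>0$. Let $\mathbf{H}_{\rm br}\in\mathbb{C}^{N\times M}$ and $\mathbf{h}_{\rm ru}\in\mathbb{C}^{N}$ be given channels, and let $\mathbf{z}_n=\mathcal{Q}(\mathbf{x}_n)\in\mathbb{C}^{M}$ be a given 1-bit transmit waveform, where $\mathbf{x}_n\in\mathbb{C}^{M}$ and $\mathcal{Q}$ is the entrywise 1-bit quantizer. Put $$\mathbf{h}_{c,n}=\mathrm{diag}\left(\mathbf{h}_{\rm ru}^{\rm H}\right)\mathbf{H}_{\rm br}\mathbf{z}_n\in\mathbb{C}^{N}.$$ For $\boldsymbol{\phi}_n=[\phi_{1,n},\ldots,\phi_{N,n}]^{\rm T}\in\mathbb{C}^{N}$ define the instantaneous received signal-to-noise ratio $$\gamma_n(\boldsymbol{\phi}_n)=\frac{\left|\boldsymbol{\phi}_n^{\rm T}\mathbf{h}_{c,n}\right|^2}{\sigma^2}=\frac{1}{\sigma^2}\left|\sum_{i=1}^{N}\phi_{i,n}[\mathbf{h}_{c,n}]_i\right|^2 .$$ Then the vector $\boldsymbol{\phi}_n^\star$ with entries $$\phi_{i,n}^\star=e^{-\jmath\,\mathrm{angle}\left([\mathbf{h}_{c,n}]_i\right)},\qquad i=1,\ldots,N,$$ is an optimal solution of the problem $$\text{maximize } \gamma_n(\boldsymbol{\phi}_n)\quad\text{over }\boldsymbol{\phi}_n\in\mathbb{C}^N\quad\text{subject to } |\phi_{i,n}|=1,\ i=1,\ldots,N.$$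
   Context: $\jmath$ is the imaginary unit; $(\cdot)^{\rm T}$ and $(\cdot)^{\rm H}$ denote transpose and conjugate transpose; $[\mathbf{v}]_i$ is the $i$th entry of a vector $\mathbf{v}$; $\mathrm{diag}(\mathbf{v}^{\rm H})$ is the diagonal matrix whose $i$th diagonal entry is the $i$th entry of $\mathbf{v}^{\rm H}$, i.e. the complex conjugate of $[\mathbf{v}]_i$. For $z\in\mathbb{C}$, $\mathrm{angle}(z)$ is the argument (phase) of $z$, so that $z=|z|e^{\jmath\,\mathrm{angle}(z)}$ (for $z=0$, any fixed real value may be used). The 1-bit quantizer is $\mathcal{Q}(z)=\mathrm{sign}(\Re(z))+\jmath\,\mathrm{sign}(\Im(z))$ for $z\in\mathbb{C}$, applied entrywise to vectors, where $\mathrm{sign}(t)=1$ for $t\ge 0$ and $\mathrm{sign}(t)=-1$ for $t<0$. Interpretation: $\mathbf{H}_{\rm br}$ is the channel from an $M$-antenna base station to a reconfigurable intelligent surface (RIS) with $N$ elements, $\mathbf{h}_{\rm ru}^{\rm H}$ is the channel from the RIS to the served single-antenna user, $n$ is a fixed time index, $\boldsymbol{\phi}_n$ is the vector of (unit-modulus, continuous-valued) instantaneous RIS phase shifts, and $\sigma^2$ is the receiver noise variance. *)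

theory Defs
  imports "HOL-Analysis.Analysis"
begin

text \<open>The library function \<^term>\<open>sgn\<close> maps \<open>0\<close> to \<open>0\<close>; the 1-bit quantizer needs the value \<open>1\<close> there.\<close>

definition sign1 :: "real \<Rightarrow> real"
  where "sign1 t = (if t \<ge> 0 then 1 else - 1)"

definition quantizer :: "complex \<Rightarrow> complex"
  where "quantizer z = complex_of_real (sign1 (Re z)) + \<i> * complex_of_real (sign1 (Im z))"

definition quantize_vec :: "complex ^ 'm \<Rightarrow> complex ^ 'm"
  where "quantize_vec x = (\<chi> i. quantizer (x $ i))"

definition diag_mat :: "complex ^ 'n \<Rightarrow> complex ^ 'n ^ 'n"
  where "diag_mat v = (\<chi> i j. if i = j then v $ i else 0)"

text \<open>\<^typ>\<open>complex ^ 'n\<close> does not distinguish rows from columns, so \<open>v\<^sup>H\<close> is the entrywise conjugate.\<close>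

definition hermitian_vec :: "complex ^ 'n \<Rightarrow> complex ^ 'n"
  where "hermitian_vec v = (\<chi> i. cnj (v $ i))"

definition cascaded_channel ::
    "complex ^ 'm ^ 'n \<Rightarrow> complex ^ 'n \<Rightarrow> complex ^ 'm \<Rightarrow> complex ^ 'n"
  where "cascaded_channel H_br h_ru z = (diag_mat (hermitian_vec h_ru) ** H_br) *v z"

text \<open>The product \<open>\<phi>\<^sup>T h\<close> is bilinear: neither vector is conjugated.\<close>

definition snr :: "real \<Rightarrow> complex ^ 'n \<Rightarrow> complex ^ 'n \<Rightarrow> real"
  where "snr noise_var h \<phi> = (cmod (\<Sum>i\<in>UNIV. \<phi> $ i * h $ i))\<^sup>2 / noise_var"

text \<open>An arbitrary choice of phase. The value at \<open>0\<close> is unconstrained, and for \<open>z \<noteq> 0\<close> the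
  value is determined up to multiples of \<open>2 * pi\<close>; the library's \<^const>\<open>Arg\<close> is one such choice.\<close>

definition phase_function :: "(complex \<Rightarrow> real) \<Rightarrow> bool"
  where "phase_function angle \<longleftrightarrow>
    (\<forall>z. z = complex_of_real (cmod z) * exp (\<i> * complex_of_real (angle z)))"

lemma phase_function_Arg: "phase_function Arg"
  unfolding phase_function_def
  by (metis Arg_eq mult_zero_left norm_zero of_real_0)

definition optimal_phases :: "(complex \<Rightarrow> real) \<Rightarrow> complex ^ 'n \<Rightarrow> complex ^ 'n"
  where "optimal_phases angle h = (\<chi> i. exp (- (\<i> * complex_of_real (angle (h $ i)))))"

end

theory Submission
  imports Defs
begin

text \<open>By the triangle inequality, the received amplitude under unit-modulus phases is at most the sum
  of the moduli of the channel entries. Cancelling the phase of every entry makes all summands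
  nonnegative reals, so this bound is attained.\<close>

lemma cmod_optimal_phases: "cmod (optimal_phases angle h $ i) = 1"
  by (simp add: optimal_phases_def)

text \<open>In the polar form of \<open>h $ i\<close> the two exponentials are inverse to each
  other. A zero entry fits too: its modulus factor kills the product whatever phase is
  chosen.\<close>

lemma optimal_phases_mult:
  assumes "phase_function angle"
  shows "optimal_phases angle h $ i * h $ i = complex_of_real (cmod (h $ i))"
proof -
  have "h $ i = complex_of_real (cmod (h $ i)) * exp (\<i> * complex_of_real (angle (h $ i)))"
    using assms unfolding phase_function_def by blast
  \<comment> \<open>Only the second factor is put in polar form: \<open>h $ i\<close> recurs inside
    that form and inside the phase, so rewriting everywhere would not end.\<close>
  then have "optimal_phases angle h $ i * h $ i =
      optimal_phases angle h $ i *
        (complex_of_real (cmod (h $ i)) * exp (\<i> * complex_of_real (angle (h $ i))))"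
    by (rule arg_cong)
  also have "\<dots> = complex_of_real (cmod (h $ i))"
    by (simp add: optimal_phases_def exp_minus)
  finally show ?thesis .
qed

lemma snr_optimal_phases:
  assumes "phase_function angle"
  shows "snr noise_var h (optimal_phases angle h) = (\<Sum>i\<in>UNIV. cmod (h $ i))\<^sup>2 / noise_var"
  unfolding snr_def optimal_phases_mult[OF assms]
  \<comment> \<open>Gathered into one real number, the sum has its absolute value as modulus, and
    squaring removes the sign.\<close>
  by (simp flip: of_real_sum)

lemma snr_le:
  assumes "noise_var > 0" and "\<And>i. cmod (\<phi> $ i) = 1"
  shows "snr noise_var h \<phi> \<le> (\<Sum>i\<in>UNIV. cmod (h $ i))\<^sup>2 / noise_var"
proof -
  have "cmod (\<Sum>i\<in>UNIV. \<phi> $ i * h $ i) \<le> (\<Sum>i\<in>UNIV. cmod (h $ i))"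
    by (rule sum_norm_le) (simp add: norm_mult assms(2))
  then show ?thesis
    unfolding snr_def using assms(1) by (intro divide_right_mono power_mono) auto
qed

theorem theorem1:
  fixes noise_var :: real
    and H_br :: "complex ^ 'm ^ 'n"
    and h_ru :: "complex ^ 'n"
    and x z :: "complex ^ 'm"
    and h_c :: "complex ^ 'n"
    and angle :: "complex \<Rightarrow> real"
  assumes "noise_var > 0"
    and "phase_function angle"
    and "z = quantize_vec x"
    and "h_c = cascaded_channel H_br h_ru z"
  shows "is_arg_max (snr noise_var h_c) (\<lambda>\<phi>. \<forall>i. cmod (\<phi> $ i) = 1) (optimal_phases angle h_c)"
  \<comment> \<open>What remains is feasibility and that no feasible point is strictly better;
    \<open>not_less\<close> turns the latter into the common upper bound.\<close>
  unfolding is_arg_max_def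
  using cmod_optimal_phases[of angle h_c] snr_optimal_phases[OF assms(2), of noise_var h_c]
    snr_le[OF assms(1), of _ h_c]
  by (auto simp: not_less)

end
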